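(* Let $\lambda\in(0,1)$, let $K>0$, and let $f\in NH_\lambda(K)$ be unbounded. Then $\mu(f)\geq\sqrt{1-\lambda}$.
   Context: $\mathbb{D}=\{z\in\mathbb{C}:|z|<1\}$. A (complex-valued) harmonic mapping $f$ in $\mathbb{D}$ is written $f=h+\overline{g}$ with $h,g$ analytic in $\mathbb{D}$. It is called sense-preserving if its Jacobian $J_f=|h'|^2-|g'|^2$ is positive throughout $\mathbb{D}$; then $h'\neq0$ in $\mathbb{D}$, and the (second complex) dilatation $\omega=g'/h'$ is analytic with $|\omega|<1$ in $\mathbb{D}$. For such $f$ define $$P_f=\partial_z\log J_f=\frac{h''}{h'}-\frac{\overline{\omega}\,\omega'}{1-|\omega|^2},\qquad A_f(z)=\frac{1-|z|^2}{2}P_f(z)-\overline{z},\quad z\in\mathbb{D},$$ the Schwarzian derivative $S_f=\partial_zP_f-\frac12(P_f)^2$, and the lower order $\mu(f)=\inf_{z\in\mathbb{D}}|A_f(z)|$. For $0<\lambda\leq1$ and $K>0$, $NH_\lambda(K)$ denotes the set of all $K$-quasiconformal sense-preserving harmonic mappings $f=h+\overline{g}$ in $\mathbb{D}$, with dilatation $\omega$, such that $$|S_f(z)|+\frac{|\omega'(z)|^2}{(1-|\omega(z)|^2)^2}\leq\frac{2\lambda}{(1-|z|^2)^2},\qquad z\in\mathbb{D}.$$ *)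

theory Defs
  imports "HOL-Complex_Analysis.Complex_Analysis"
begin

text \<open>The Wirtinger derivatives \<open>\<partial>\<^sub>z = (\<partial>\<^sub>x - \<i> \<partial>\<^sub>y) / 2\<close> and
  \<open>(\<partial>\<^sub>x + \<i> \<partial>\<^sub>y) / 2\<close>, expressed through the real Frechet derivative.\<close>

definition wirt_z :: "(complex \<Rightarrow> complex) \<Rightarrow> complex \<Rightarrow> complex" where
  "wirt_z F z = (frechet_derivative F (at z) 1 - \<i> * frechet_derivative F (at z) \<i>) / 2"

definition wirt_zbar :: "(complex \<Rightarrow> complex) \<Rightarrow> complex \<Rightarrow> complex" where
  "wirt_zbar F z = (frechet_derivative F (at z) 1 + \<i> * frechet_derivative F (at z) \<i>) / 2"

definition harmonic_decomp ::
  "(complex \<Rightarrow> complex) \<Rightarrow> (complex \<Rightarrow> complex) \<Rightarrow> (complex \<Rightarrow> complex) \<Rightarrow> bool" where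
  "harmonic_decomp f h g \<longleftrightarrow>
     h holomorphic_on ball 0 1 \<and> g holomorphic_on ball 0 1 \<and>
     (\<forall>z\<in>ball 0 1. f z = h z + cnj (g z))"

definition harmonic_mapping :: "(complex \<Rightarrow> complex) \<Rightarrow> bool" where
  "harmonic_mapping f \<longleftrightarrow> (\<exists>h g. harmonic_decomp f h g)"

text \<open>The quantities below depend on \<open>f = h + cnj g\<close> only, not on the choice of \<open>h\<close> and \<open>g\<close>
  (which are unique up to additive constants), since \<open>h'\<close> is the \<open>z\<close>-derivative of \<open>f\<close> and
  \<open>cnj g'\<close> its conjugate derivative. The lemmas at the end express them in terms of \<open>h\<close>
  and \<open>g\<close>.\<close>

definition jac :: "(complex \<Rightarrow> complex) \<Rightarrow> complex \<Rightarrow> real" where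
  "jac f z = (cmod (wirt_z f z))\<^sup>2 - (cmod (wirt_zbar f z))\<^sup>2"

definition sense_preserving :: "(complex \<Rightarrow> complex) \<Rightarrow> bool" where
  "sense_preserving f \<longleftrightarrow> (\<forall>z\<in>ball 0 1. jac f z > 0)"

definition dilatation :: "(complex \<Rightarrow> complex) \<Rightarrow> complex \<Rightarrow> complex" where
  "dilatation f z = cnj (wirt_zbar f z) / wirt_z f z"

definition pre_schwarzian :: "(complex \<Rightarrow> complex) \<Rightarrow> complex \<Rightarrow> complex" where
  "pre_schwarzian f z = wirt_z (\<lambda>w. complex_of_real (ln (jac f w))) z"

definition schwarzian :: "(complex \<Rightarrow> complex) \<Rightarrow> complex \<Rightarrow> complex" where
  "schwarzian f z = wirt_z (pre_schwarzian f) z - (pre_schwarzian f z)\<^sup>2 / 2"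

definition A_op :: "(complex \<Rightarrow> complex) \<Rightarrow> complex \<Rightarrow> complex" where
  "A_op f z = complex_of_real ((1 - (cmod z)\<^sup>2) / 2) * pre_schwarzian f z - cnj z"

definition lower_order :: "(complex \<Rightarrow> complex) \<Rightarrow> real" where
  "lower_order f = (INF z\<in>ball 0 1. cmod (A_op f z))"

text \<open>\<open>K\<close>-quasiconformality of a smooth sense-preserving map of the disk: a homeomorphism onto
  its image whose ratio of largest to smallest stretching is at most \<open>K\<close> everywhere, that is,
  \<open>\<bar>\<omega>\<bar> \<le> (K - 1) / (K + 1)\<close>. For such maps this agrees with the analytic (Sobolev) definition.
  Together with sense preservation it forces \<open>K \<ge> 1\<close>.\<close>

definition quasiconformal :: "real \<Rightarrow> (complex \<Rightarrow> complex) \<Rightarrow> bool" where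
  "quasiconformal K f \<longleftrightarrow>
     (\<exists>f'. homeomorphism (ball 0 1) (f ` ball 0 1) f f') \<and>
     (\<forall>z\<in>ball 0 1. cmod (wirt_z f z) + cmod (wirt_zbar f z)
                     \<le> K * (cmod (wirt_z f z) - cmod (wirt_zbar f z)))"

definition NH :: "real \<Rightarrow> real \<Rightarrow> (complex \<Rightarrow> complex) set" where
  "NH lam K = {f. harmonic_mapping f \<and> sense_preserving f \<and> quasiconformal K f \<and>
     (\<forall>z\<in>ball 0 1.
        cmod (schwarzian f z)
          + (cmod (deriv (dilatation f) z))\<^sup>2 / (1 - (cmod (dilatation f z))\<^sup>2)\<^sup>2
        \<le> 2 * lam / (1 - (cmod z)\<^sup>2)\<^sup>2)}"

lemma wirt_eqI:
  assumes "(F has_derivative D) (at z)"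
  shows "wirt_z F z = (D 1 - \<i> * D \<i>) / 2" "wirt_zbar F z = (D 1 + \<i> * D \<i>) / 2"
  using frechet_derivative_at[OF assms] by (simp_all add: wirt_z_def wirt_zbar_def)

lemma wirt_harmonic:
  assumes f: "harmonic_decomp f h g" and z: "z \<in> ball 0 1"
  shows "wirt_z f z = deriv h z" "wirt_zbar f z = cnj (deriv g z)"
proof -
  from f z have "h field_differentiable at z" "g field_differentiable at z"
    by (auto simp: harmonic_decomp_def holomorphic_on_open field_differentiable_def)
  then have hg: "(h has_derivative (*) (deriv h z)) (at z)"
    "(g has_derivative (*) (deriv g z)) (at z)"
    by (auto simp: field_differentiable_derivI has_field_derivative_imp_has_derivative)
  have "((\<lambda>w. h w + cnj (g w)) has_derivative (\<lambda>t. deriv h z * t + cnj (deriv g z * t))) (at z)"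
    by (intro derivative_intros hg)
  then have D: "(f has_derivative (\<lambda>t. deriv h z * t + cnj (deriv g z * t))) (at z)"
    by (rule has_derivative_transform_within_open[OF _ open_ball z])
      (use f in \<open>auto simp: harmonic_decomp_def\<close>)
  show "wirt_z f z = deriv h z" "wirt_zbar f z = cnj (deriv g z)"
    unfolding wirt_eqI[OF D] by (simp_all add: algebra_simps)
qed

lemma jac_harmonic:
  assumes "harmonic_decomp f h g" and "z \<in> ball 0 1"
  shows "jac f z = (cmod (deriv h z))\<^sup>2 - (cmod (deriv g z))\<^sup>2"
  using wirt_harmonic[OF assms] by (simp add: jac_def)

lemma dilatation_harmonic:
  assumes "harmonic_decomp f h g" and "z \<in> ball 0 1"
  shows "dilatation f z = deriv g z / deriv h z"
  using wirt_harmonic[OF assms] by (simp add: dilatation_def)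

lemma pre_schwarzian_harmonic:
  assumes f: "harmonic_decomp f h g" and sp: "sense_preserving f" and z: "z \<in> ball 0 1"
  shows "pre_schwarzian f z = deriv (deriv h) z / deriv h z
    - cnj (dilatation f z) * deriv (dilatation f) z
        / complex_of_real (1 - (cmod (dilatation f z))\<^sup>2)"
proof -
  define a b where "a = deriv h z" and "b = deriv g z"
  define a' b' where "a' = deriv (deriv h) z" and "b' = deriv (deriv g) z"
  have hol: "deriv h holomorphic_on ball 0 1" "deriv g holomorphic_on ball 0 1"
    using f by (auto simp: harmonic_decomp_def intro!: holomorphic_deriv)
  then have df: "(deriv h has_field_derivative a') (at z)" "(deriv g has_field_derivative b') (at z)"
    using z by (auto simp: a'_def b'_def intro: holomorphic_derivI)
  then have hd: "(deriv h has_derivative (*) a') (at z)" "(deriv g has_derivative (*) b') (at z)"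
    by (auto simp: has_field_derivative_imp_has_derivative)
  have "jac f z = a \<bullet> a - b \<bullet> b"
    using jac_harmonic[OF f z] by (simp add: a_def b_def power2_norm_eq_inner)
  moreover have "jac f z > 0"
    using sp z unfolding sense_preserving_def by blast
  ultimately have Jpos: "a \<bullet> a - b \<bullet> b > 0"
    by simp
  have a0: "a \<noteq> 0"
    using Jpos inner_ge_zero[of b] by (auto simp del: inner_ge_zero)
  have "((\<lambda>w. complex_of_real (ln (deriv h w \<bullet> deriv h w - deriv g w \<bullet> deriv g w)))
      has_derivative (\<lambda>t. complex_of_real
        ((2 * (a \<bullet> (a' * t)) - 2 * (b \<bullet> (b' * t))) / (a \<bullet> a - b \<bullet> b)))) (at z)"
    using Jpos unfolding a_def b_def
    by (auto intro!: derivative_eq_intros hd simp: inner_commute field_simps)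
  then have "((\<lambda>w. complex_of_real (ln (jac f w)))
      has_derivative (\<lambda>t. complex_of_real
        ((2 * (a \<bullet> (a' * t)) - 2 * (b \<bullet> (b' * t))) / (a \<bullet> a - b \<bullet> b)))) (at z)"
    by (rule has_derivative_transform_within_open[OF _ open_ball z])
      (simp add: jac_harmonic[OF f] power2_norm_eq_inner)
  note P0 = wirt_eqI(1)[OF this]
  have Jc: "a * cnj a - b * cnj b = complex_of_real (a \<bullet> a - b \<bullet> b)"
    by (simp add: complex_mult_cnj inner_complex_def power2_eq_square)
  have lin: "complex_of_real (c \<bullet> (c' * 1)) - \<i> * complex_of_real (c \<bullet> (c' * \<i>)) = cnj c * c'"
    for c c' :: complex
    by (simp add: complex_eq_iff inner_complex_def algebra_simps)
  have alg: "((2 * p - 2 * q) / d - \<i> * ((2 * r - 2 * s) / d)) / 2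
      = ((p - \<i> * r) - (q - \<i> * s)) / d" for p q r s d :: complex
    by (cases "d = 0") (simp_all add: field_simps)
  have "pre_schwarzian f z
      = ((complex_of_real (a \<bullet> (a' * 1)) - \<i> * complex_of_real (a \<bullet> (a' * \<i>)))
        - (complex_of_real (b \<bullet> (b' * 1)) - \<i> * complex_of_real (b \<bullet> (b' * \<i>))))
        / complex_of_real (a \<bullet> a - b \<bullet> b)"
    unfolding pre_schwarzian_def P0 of_real_divide of_real_diff of_real_mult of_real_numeral
    by (rule alg)
  then have P: "pre_schwarzian f z = (cnj a * a' - cnj b * b') / (a * cnj a - b * cnj b)"
    unfolding lin Jc .
  have "((\<lambda>w. deriv g w / deriv h w) has_field_derivative (b' * a - b * a') / (a * a)) (at z)"
    using a0 unfolding a_def b_def by (auto intro!: derivative_eq_intros df)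
  then have "(dilatation f has_field_derivative (b' * a - b * a') / (a * a)) (at z)"
    by (rule has_field_derivative_transform_within_open[OF _ open_ball z])
      (simp add: dilatation_harmonic[OF f])
  then have d: "deriv (dilatation f) z = (b' * a - b * a') / (a * a)"
    by (rule DERIV_imp_deriv)
  have w: "dilatation f z = b / a"
    by (simp add: dilatation_harmonic[OF f z] a_def b_def)
  have n: "complex_of_real (1 - (cmod (b / a))\<^sup>2) = (a * cnj a - b * cnj b) / (a * cnj a)"
    using a0 by (simp add: norm_divide power_divide complex_norm_square diff_divide_distrib
        del: of_real_power)
  have nz: "a * cnj a - b * cnj b \<noteq> 0"
    unfolding Jc using Jpos by (metis less_irrefl of_real_eq_0_iff)
  have alg': "(A * a' - B * b') / J = a' / a - B / A * ((b' * a - b * a') / (a * a)) / (J / (a * A))"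
    if "A \<noteq> 0" "J \<noteq> 0" "J = a * A - b * B" for A B J
  proof -
    have "a' / a - B / A * ((b' * a - b * a') / (a * a)) / (J / (a * A))
        = (a' * J - B * (b' * a - b * a')) / (a * J)"
      using that(1,2) a0 by (simp add: field_simps)
    also have "a' * J - B * (b' * a - b * a') = a * (A * a' - B * b')"
      unfolding that(3) by (simp add: algebra_simps)
    finally show ?thesis
      using a0 by simp
  qed
  show ?thesis
    unfolding P d w n complex_cnj_divide a_def[symmetric] a'_def[symmetric]
    using a0 nz by (intro alg') auto
qed

end

theory Submission
  imports Defs
begin

text \<open>
  The contrapositive holds with an explicit bound: with \<open>\<alpha> = sqrt (1 - \<lambda>)\<close>, a point \<open>a\<close> where
  \<open>\<bar>A\<^sub>f(a)\<bar> < \<alpha>\<close> forces \<open>f\<close> to be bounded.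

  Let \<open>\<zeta>\<close> be a hyperbolic geodesic with \<open>\<zeta>(0) = a\<close>, parametrized so that
  \<open>\<bar>\<zeta>'\<bar> = 1 - \<bar>\<zeta>\<bar>\<^sup>2\<close>, and let \<open>V(t)\<close> be the power \<open>-1/4\<close> of \<open>J\<^sub>f(\<zeta>(t)) \<bar>\<zeta>'(t)\<bar>\<^sup>2\<close>. For analytic \<open>f\<close>
  this is the modulus of the square root of \<open>1 / (f \<circ> \<zeta>)'\<close>, which solves the linear equation
  \<open>y'' + (S/2) y = 0\<close> with the Schwarzian \<open>S\<close> of \<open>f \<circ> \<zeta>\<close>. In the harmonic case an inequality
  remains. Put \<open>Q = P\<^sub>f(\<zeta>) \<zeta>' + \<zeta>''/\<zeta>'\<close>, so that \<open>V' = - (Re Q / 2) V\<close>. As \<open>\<zeta>\<close> is a Moebius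
  transformation of \<open>tanh t\<close>, its own Schwarzian is \<open>-2\<close>, and as the conjugate derivative of
  \<open>P\<^sub>f\<close> is \<open>- \<bar>\<omega>'\<bar>\<^sup>2 / (1 - \<bar>\<omega>\<bar>\<^sup>2)\<^sup>2\<close>,

  \<open>Q' = S\<^sub>f(\<zeta>) \<zeta>'\<^sup>2 + Q\<^sup>2 / 2 - 2 - \<bar>\<omega>'\<bar>\<^sup>2 \<bar>\<zeta>'\<bar>\<^sup>2 / (1 - \<bar>\<omega>\<bar>\<^sup>2)\<^sup>2\<close>

  (\<open>geo_pre_derivative\<close>). Since \<open>Re (Q\<^sup>2) = (Re Q)\<^sup>2 - (Im Q)\<^sup>2\<close>, the squares of \<open>Re Q\<close> cancel in
  \<open>V''/V\<close>, and what is left gives \<open>V'' \<ge> (1 - \<lambda>) V = \<alpha>\<^sup>2 V\<close>.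

  The initial slope is governed by \<open>A\<^sub>f\<close>: \<open>Q(0)\<close> is \<open>2 A\<^sub>f(a)\<close> times a unimodular number, so
  \<open>V'(0) \<ge> - \<bar>A\<^sub>f(a)\<bar> V(0)\<close>. If \<open>\<bar>A\<^sub>f(a)\<bar> < \<alpha>\<close>, this slope is too shallow for \<open>V\<close> to follow the decaying
  solution of \<open>y'' = \<alpha>\<^sup>2 y\<close>, and \<open>V\<close> dominates a multiple of the growing one, \<open>exp (\<alpha> t)\<close>
  (\<open>exponential_growth_comparison\<close>, \<open>jacobian_decay\<close>). Quasiconformality bounds the speed of
  \<open>f \<circ> \<zeta>\<close> by \<open>sqrt K / V\<^sup>2\<close>, hence by a multiple of \<open>exp (- 2 \<alpha> t)\<close>, which is integrable on the
  half-line. The images of all geodesic rays from \<open>a\<close> therefore have lengths below one common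
  bound (\<open>growth_along_geodesic\<close>), and these rays cover the disk.
\<close>

section \<open>Wirtinger derivatives\<close>

lemma wirt_z_eqI:
  assumes "(F has_derivative (\<lambda>v. p * v + q * cnj v)) (at z)"
  shows "wirt_z F z = p"
  unfolding wirt_eqI[OF assms] by (simp add: algebra_simps)

text \<open>For real-valued functions the two Wirtinger derivatives are conjugate to each other, so one of
  them determines the differential.\<close>

lemma has_derivative_real_wirtinger:
  fixes r :: "complex \<Rightarrow> real"
  assumes "(r has_derivative D) (at z)"
  shows "(r has_derivative (\<lambda>v. 2 * Re (wirt_z (\<lambda>w. complex_of_real (r w)) z * v))) (at z)"
proof -
  interpret bounded_linear D
    using assms by (rule has_derivative_bounded_linear)
  have "((\<lambda>w. complex_of_real (r w)) has_derivative (\<lambda>v. complex_of_real (D v))) (at z)"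
    by (intro derivative_intros assms)
  note eq = wirt_eqI(1)[OF this]
  have "D v = 2 * Re (wirt_z (\<lambda>w. complex_of_real (r w)) z * v)" for v
  proof -
    have "v = Re v *\<^sub>R 1 + Im v *\<^sub>R \<i>"
      by (simp add: complex_eq_iff)
    then have "D v = Re v *\<^sub>R D 1 + Im v *\<^sub>R D \<i>"
      by (metis add scaleR)
    then show ?thesis
      unfolding eq by (simp add: field_simps)
  qed
  then have "D = (\<lambda>v. 2 * Re (wirt_z (\<lambda>w. complex_of_real (r w)) z * v))" ..
  with assms show ?thesis
    by simp
qed

section \<open>The pre-Schwarzian\<close>

lemma sense_preserving_dilatation:
  assumes f: "harmonic_decomp f h g" and sp: "sense_preserving f" and z: "z \<in> ball 0 1"
  shows "deriv h z \<noteq> 0" "cmod (dilatation f z) < 1"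
proof -
  have "(cmod (deriv g z))\<^sup>2 < (cmod (deriv h z))\<^sup>2"
    using bspec[OF sp[unfolded sense_preserving_def] z] jac_harmonic[OF f z] by simp
  then have lt: "cmod (deriv g z) < cmod (deriv h z)"
    by (rule power2_less_imp_less) simp
  then show "deriv h z \<noteq> 0"
    by auto
  with lt show "cmod (dilatation f z) < 1"
    by (simp add: dilatation_harmonic[OF f z] norm_divide)
qed

lemma has_derivative_ln_jac:
  assumes f: "harmonic_decomp f h g" and sp: "sense_preserving f" and z: "z \<in> ball 0 1"
  shows "((\<lambda>w. ln (jac f w)) has_derivative (\<lambda>v. 2 * Re (pre_schwarzian f z * v))) (at z)"
proof -
  have "deriv h holomorphic_on ball 0 1" "deriv g holomorphic_on ball 0 1"
    using f by (auto simp: harmonic_decomp_def intro!: holomorphic_deriv)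
  then have hd: "(deriv h has_derivative (*) (deriv (deriv h) z)) (at z)"
      "(deriv g has_derivative (*) (deriv (deriv g) z)) (at z)"
    using z by (auto intro!: has_field_derivative_imp_has_derivative holomorphic_derivI)
  have jac: "jac f w = deriv h w \<bullet> deriv h w - deriv g w \<bullet> deriv g w" if "w \<in> ball 0 1" for w
    using jac_harmonic[OF f that] by (simp add: power2_norm_eq_inner)
  have "jac f z > 0"
    using sp z by (auto simp: sense_preserving_def)
  then have "deriv h z \<bullet> deriv h z - deriv g z \<bullet> deriv g z > 0"
    using jac[OF z] by simp
  then have "((\<lambda>w. ln (deriv h w \<bullet> deriv h w - deriv g w \<bullet> deriv g w)) has_derivative
      (\<lambda>t. (2 * (deriv h z \<bullet> (deriv (deriv h) z * t)) - 2 * (deriv g z \<bullet> (deriv (deriv g) z * t)))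
        / (deriv h z \<bullet> deriv h z - deriv g z \<bullet> deriv g z))) (at z)"
    by (auto intro!: derivative_eq_intros hd simp: inner_commute field_simps)
  then have "((\<lambda>w. ln (jac f w)) has_derivative
      (\<lambda>t. (2 * (deriv h z \<bullet> (deriv (deriv h) z * t)) - 2 * (deriv g z \<bullet> (deriv (deriv g) z * t)))
        / (deriv h z \<bullet> deriv h z - deriv g z \<bullet> deriv g z))) (at z)"
    by (rule has_derivative_transform_within_open[OF _ open_ball z]) (simp add: jac)
  from has_derivative_real_wirtinger[OF this] show ?thesis
    unfolding pre_schwarzian_def .
qed

text \<open>The analytic term \<open>h''/h'\<close> of the pre-Schwarzian contributes only to the complex-linear part of
  the differential. The conjugate-linear part comes from
  \<open>\<omega>' cnj \<omega> / (1 - \<omega> cnj \<omega>)\<close> alone, whose derivative in \<open>cnj \<omega>\<close>, with \<open>\<omega>\<close> and \<open>\<omega>'\<close> held fixed,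
  is \<open>\<omega>' / (1 - \<omega> cnj \<omega>)\<^sup>2\<close>.\<close>

lemma has_derivative_pre_schwarzian:
  assumes f: "harmonic_decomp f h g" and sp: "sense_preserving f" and z: "z \<in> ball 0 1"
  shows "(pre_schwarzian f has_derivative
    (\<lambda>v. (schwarzian f z + (pre_schwarzian f z)\<^sup>2 / 2) * v
       - complex_of_real ((cmod (deriv (dilatation f) z))\<^sup>2 / (1 - (cmod (dilatation f z))\<^sup>2)\<^sup>2)
         * cnj v)) (at z)"
proof -
  let ?w = "dilatation f"
  have hol: "deriv h holomorphic_on ball 0 1" "deriv g holomorphic_on ball 0 1"
    using f by (auto simp: harmonic_decomp_def intro!: holomorphic_deriv)
  have nz: "deriv h w \<noteq> 0" if "w \<in> ball 0 1" for w
    using sense_preserving_dilatation(1)[OF f sp that] .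
  have "(\<lambda>w. deriv g w / deriv h w) holomorphic_on ball 0 1"
    using hol nz by (intro holomorphic_on_divide)
  then have w: "?w holomorphic_on ball 0 1"
    by (rule holomorphic_transform) (simp add: dilatation_harmonic[OF f])
  then have w': "deriv ?w holomorphic_on ball 0 1"
    by (auto intro!: holomorphic_deriv)
  have "(\<lambda>w. deriv (deriv h) w / deriv h w) holomorphic_on ball 0 1"
    using hol nz by (intro holomorphic_on_divide holomorphic_deriv[of "deriv h"] open_ball)
  moreover define r where "r = (\<lambda>w. deriv (deriv h) w / deriv h w)"
  ultimately obtain d where d: "(r has_derivative (*) d) (at z)"
    using z by (metis holomorphic_derivI open_ball has_field_derivative_imp_has_derivative)
  have dw: "(?w has_derivative (*) (deriv ?w z)) (at z)"
    "(deriv ?w has_derivative (*) (deriv (deriv ?w) z)) (at z)"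
    using z w w' by (auto intro!: has_field_derivative_imp_has_derivative holomorphic_derivI)
  define W where "W = ?w z"
  define W1 where "W1 = deriv ?w z"
  define W2 where "W2 = deriv (deriv ?w) z"
  have "(cmod W)\<^sup>2 < 1"
    using sense_preserving_dilatation(2)[OF f sp z] by (simp add: W_def abs_square_less_1)
  moreover have cn: "1 - W * cnj W = complex_of_real (1 - (cmod W)\<^sup>2)"
    by (simp add: complex_norm_square del: of_real_power)
  ultimately have W0: "1 - W * cnj W \<noteq> 0"
    by (metis less_irrefl of_real_eq_0_iff right_minus_eq)
  define p where "p = d - (cnj W * W2 * (1 - W * cnj W) + cnj W * W1 * (W1 * cnj W)) / (1 - W * cnj W)\<^sup>2"
  have "((\<lambda>w. r w - cnj (?w w) * deriv ?w w / (1 - ?w w * cnj (?w w)))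
      has_derivative (\<lambda>v. p * v + (- (W1 * cnj W1) / (1 - W * cnj W)\<^sup>2) * cnj v)) (at z)"
    using W0 unfolding p_def
    by (auto intro!: derivative_eq_intros d dw simp flip: W_def W1_def W2_def)
      (simp add: fun_eq_iff divide_simps power2_eq_square, simp add: algebra_simps)
  then have D: "(pre_schwarzian f has_derivative
      (\<lambda>v. p * v + (- (W1 * cnj W1) / (1 - W * cnj W)\<^sup>2) * cnj v)) (at z)"
    by (rule has_derivative_transform_within_open[OF _ open_ball z])
      (simp add: pre_schwarzian_harmonic[OF f sp] r_def complex_norm_square del: of_real_power)
  have "p = schwarzian f z + (pre_schwarzian f z)\<^sup>2 / 2"
    using wirt_z_eqI[OF D] by (simp add: schwarzian_def)
  moreover have "- (W1 * cnj W1) / (1 - W * cnj W)\<^sup>2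
      = - complex_of_real ((cmod W1)\<^sup>2 / (1 - (cmod W)\<^sup>2)\<^sup>2)"
    unfolding cn by (simp add: complex_norm_square[of W1] del: of_real_power) simp
  ultimately show ?thesis
    using D by (simp add: W_def W1_def)
qed

section \<open>Geodesics of the disk\<close>

text \<open>A geodesic is a disk automorphism applied to the diameter \<open>tanh t\<close>. The parameter \<open>e\<close> is the
  initial direction. The base point is \<open>a = e cnj c\<close>, encoded through \<open>c = e cnj a\<close>: with this choice the
  denominator and the logarithmic derivative of the velocity involve \<open>c\<close> and \<open>tanh t\<close> only.\<close>

locale disk_geodesic =
  fixes e c :: complex
  assumes norm_e: "cmod e = 1" and norm_c: "cmod c < 1"
begin

definition den :: "real \<Rightarrow> complex" where
  "den t = 1 + c * complex_of_real (tanh t)"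

definition geo :: "real \<Rightarrow> complex" where
  "geo t = e * (complex_of_real (tanh t) + cnj c) / den t"

definition geo' :: "real \<Rightarrow> complex" where
  "geo' t = e * complex_of_real ((1 - (cmod c)\<^sup>2) * (1 - (tanh t)\<^sup>2)) / (den t)\<^sup>2"

text \<open>This is \<open>- geo'' / (2 geo')\<close>. Like \<open>tanh\<close> it solves the Riccati equation \<open>y' = 1 - y\<^sup>2\<close>
  (\<open>accel_derivative\<close>), which says that the Schwarzian derivative of the geodesic is the constant \<open>-2\<close>.\<close>

definition accel :: "real \<Rightarrow> complex" where
  "accel t = (complex_of_real (tanh t) + c) / den t"

lemma tanh_sq_less_1: "(tanh t)\<^sup>2 < (1::real)"
  using tanh_real_bounds[of t] by (auto simp: abs_square_less_1 abs_less_iff)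

lemma c_sq_less_1: "(cmod c)\<^sup>2 < 1"
  using norm_c by (simp add: abs_square_less_1)

lemma den_nonzero: "den t \<noteq> 0"
proof
  assume "den t = 0"
  then have "c * complex_of_real (tanh t) = -1"
    by (simp add: den_def add_eq_0_iff minus_equation_iff[of _ 1])
  then have "cmod c * \<bar>tanh t\<bar> = 1"
    by (metis norm_minus_cancel norm_mult norm_of_real norm_one)
  moreover have "cmod c * \<bar>tanh t\<bar> \<le> cmod c"
    using tanh_real_bounds[of t] by (intro mult_left_le) auto
  ultimately show False
    using norm_c by simp
qed

lemma tanh_vector_derivative:
  "((\<lambda>t. complex_of_real (tanh t)) has_vector_derivative 1 - (complex_of_real (tanh t))\<^sup>2) (at t)"
proof -
  have "(tanh has_real_derivative 1 - (tanh t)\<^sup>2) (at t)"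
    by (auto intro!: derivative_eq_intros)
  then show ?thesis
    using has_vector_derivative_of_real by fastforce
qed

lemma vector_derivative_of_tanh:
  assumes "(F has_field_derivative d) (at (complex_of_real (tanh t)))"
  shows "((\<lambda>t. F (complex_of_real (tanh t))) has_vector_derivative
    d * (1 - (complex_of_real (tanh t))\<^sup>2)) (at t)"
  using field_vector_diff_chain_at[OF tanh_vector_derivative assms]
  by (simp add: o_def mult.commute)

lemma geo_derivative: "(geo has_vector_derivative geo' t) (at t)"
proof -
  have cc: "complex_of_real (1 - (cmod c)\<^sup>2) = 1 - c * cnj c"
    by (simp add: complex_norm_square del: of_real_power)
  have "((\<lambda>x. e * (x + cnj c) / (1 + c * x)) has_field_derivative
      e * (1 - c * cnj c) / (den t)\<^sup>2) (at (complex_of_real (tanh t)))"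
    using den_nonzero[of t]
    by (auto intro!: derivative_eq_intros simp: den_def divide_simps power2_eq_square algebra_simps)
  from vector_derivative_of_tanh[OF this] show ?thesis
    unfolding geo_def[abs_def] geo'_def of_real_mult cc by (simp add: den_def[abs_def] mult_ac)
qed

lemma geo'_derivative: "(geo' has_vector_derivative - 2 * accel t * geo' t) (at t)"
proof -
  define x where "x = complex_of_real (tanh t)"
  define k where "k = e * complex_of_real (1 - (cmod c)\<^sup>2)"
  define y where "y = 1 + c * x"
  have y: "y \<noteq> 0"
    using den_nonzero[of t] by (simp add: den_def x_def y_def)
  have "k * (- 2 * x) * y\<^sup>2 - k * (1 - x\<^sup>2) * (2 * y * c) = - 2 * k * y * (x * y + (1 - x\<^sup>2) * c)"
    by (simp add: power2_eq_square algebra_simps)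
  also have "x * y + (1 - x\<^sup>2) * c = x + c"
    by (simp add: y_def power2_eq_square algebra_simps)
  finally have num: "k * (- 2 * x) * y\<^sup>2 - k * (1 - x\<^sup>2) * (2 * y * c) = - 2 * k * y * (x + c)" .
  have "((\<lambda>x. k * (1 - x\<^sup>2) / (1 + c * x)\<^sup>2) has_field_derivative
      (k * (- 2 * x) * y\<^sup>2 - k * (1 - x\<^sup>2) * (2 * y * c)) / (y\<^sup>2 * y\<^sup>2)) (at x)"
    using y unfolding y_def by (auto intro!: derivative_eq_intros simp: mult_ac)
  then have "((\<lambda>x. k * (1 - x\<^sup>2) / (1 + c * x)\<^sup>2) has_field_derivative
      - 2 * (x + c) / y * (k / y\<^sup>2)) (at x)"
  proof (rule DERIV_cong)
    show "(k * (- 2 * x) * y\<^sup>2 - k * (1 - x\<^sup>2) * (2 * y * c)) / (y\<^sup>2 * y\<^sup>2)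
        = - 2 * (x + c) / y * (k / y\<^sup>2)"
      unfolding num using y by (simp add: divide_simps power2_eq_square) (simp add: algebra_simps)
  qed
  from vector_derivative_of_tanh[OF this[unfolded x_def]] show ?thesis
    unfolding geo'_def[abs_def] accel_def
    by (simp add: den_def[abs_def] mult_ac k_def y_def x_def)
qed

lemma accel_derivative: "(accel has_vector_derivative 1 - (accel t)\<^sup>2) (at t)"
proof -
  define x where "x = complex_of_real (tanh t)"
  have n: "1 + c * x \<noteq> 0"
    using den_nonzero[of t] by (simp add: den_def x_def)
  then have "((\<lambda>x. (x + c) / (1 + c * x)) has_field_derivative (1 - c\<^sup>2) / (1 + c * x)\<^sup>2) (at x)"
    by (auto intro!: derivative_eq_intros simp: divide_simps power2_eq_square algebra_simps)
  from vector_derivative_of_tanh[OF this[unfolded x_def]]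
  have "(accel has_vector_derivative (1 - c\<^sup>2) / (1 + c * x)\<^sup>2 * (1 - x\<^sup>2)) (at t)"
    by (simp add: accel_def[abs_def] den_def[abs_def] x_def)
  moreover have "(1 - c\<^sup>2) / (1 + c * x)\<^sup>2 * (1 - x\<^sup>2) = 1 - (accel t)\<^sup>2"
    using n unfolding accel_def den_def x_def[symmetric]
    by (simp add: divide_simps) (simp add: power2_eq_square algebra_simps)
  ultimately show ?thesis
    by simp
qed

lemma geo'_nonzero: "geo' t \<noteq> 0"
proof -
  have "(1 - (cmod c)\<^sup>2) * (1 - (tanh t)\<^sup>2) \<noteq> 0"
    using c_sq_less_1 tanh_sq_less_1[of t] by simp
  then show ?thesis
    using norm_e den_nonzero[of t] unfolding geo'_def by (auto simp del: of_real_mult of_real_diff)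
qed

text \<open>Unit speed in the hyperbolic metric \<open>\<bar>dz\<bar> / (1 - \<bar>z\<bar>\<^sup>2)\<close>. It turns the weight
  \<open>(1 - \<bar>z\<bar>\<^sup>2)\<^sup>2\<close> of the Schwarzian bound into \<open>\<bar>geo'\<bar>\<^sup>2\<close>.\<close>

lemma geo_unit_speed: "cmod (geo' t) = 1 - (cmod (geo t))\<^sup>2"
proof -
  define x where "x = tanh t"
  have "cmod (geo' t) = (1 - (cmod c)\<^sup>2) * (1 - x\<^sup>2) / (cmod (den t))\<^sup>2"
    using c_sq_less_1 tanh_sq_less_1[of t] norm_e
    by (simp add: geo'_def norm_mult norm_divide norm_power x_def del: of_real_mult of_real_diff)
  also have "(1 - (cmod c)\<^sup>2) * (1 - x\<^sup>2) = (cmod (den t))\<^sup>2 - (cmod (complex_of_real x + cnj c))\<^sup>2"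
    unfolding den_def x_def[symmetric] cmod_power2 by (simp add: power2_eq_square algebra_simps)
  also have "\<dots> / (cmod (den t))\<^sup>2 = 1 - (cmod (geo t))\<^sup>2"
    using den_nonzero[of t] norm_e
    by (simp add: geo_def x_def norm_mult norm_divide diff_divide_distrib power_divide)
  finally show ?thesis .
qed

lemma geo_in_disk: "geo t \<in> ball 0 1"
proof -
  have "cmod (geo' t) > 0"
    using geo'_nonzero by simp
  then show ?thesis
    by (simp add: geo_unit_speed abs_square_less_1)
qed

lemma geo_0: "geo 0 = e * cnj c" "geo' 0 = e * complex_of_real (1 - (cmod c)\<^sup>2)" "accel 0 = c"
  by (simp_all add: geo_def geo'_def accel_def den_def)

end

text \<open>The geodesic with \<open>c = e cnj a\<close> starts at \<open>a\<close>. The automorphism sending \<open>a\<close> to \<open>0\<close> carries \<open>z\<close> to a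
  point \<open>u\<close>, whose argument is the direction \<open>e\<close> and whose modulus is \<open>tanh t\<close>.\<close>

lemma geodesic_through_two_points:
  assumes a: "cmod a < 1" and z: "cmod z < 1"
  obtains e t where "cmod e = 1" "t \<ge> 0" "disk_geodesic.geo e (cnj a * e) t = z"
    "disk_geodesic e (cnj a * e)"
proof -
  define u where "u = (z - a) / (1 - cnj a * z)"
  have az: "1 - cnj a * z \<noteq> 0"
  proof
    assume "1 - cnj a * z = 0"
    then have "cmod (cnj a * z) = 1" by (metis norm_one right_minus_eq)
    moreover have "cmod a * cmod z \<le> cmod a"
      using z by (intro mult_left_le) auto
    ultimately show False using a by (simp add: norm_mult)
  qed
  have "0 < (1 - (cmod a)\<^sup>2) * (1 - (cmod z)\<^sup>2)"
    using a z by (simp add: abs_square_less_1)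
  also have "\<dots> = (cmod (1 - cnj a * z))\<^sup>2 - (cmod (z - a))\<^sup>2"
    unfolding cmod_power2 by (simp add: power2_eq_square algebra_simps)
  finally have "(cmod (z - a))\<^sup>2 < (cmod (1 - cnj a * z))\<^sup>2"
    by simp
  then have "cmod (z - a) < cmod (1 - cnj a * z)"
    by (rule power2_less_imp_less) simp
  then have u: "cmod u < 1"
    using az by (simp add: u_def norm_divide)
  define e where "e = (if u = 0 then 1 else sgn u)"
  have e: "cmod e = 1" "e * complex_of_real (cmod u) = u"
    by (simp add: e_def norm_sgn) (simp add: e_def sgn_eq)
  define t where "t = artanh (cmod u)"
  have "1 \<le> (1 + cmod u) / (1 - cmod u)"
    using u by simp
  then have t0: "t \<ge> 0"
    unfolding t_def artanh_def by (intro divide_nonneg_pos ln_ge_zero) auto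
  have tu: "tanh t = cmod u"
  proof -
    have "exp (2 * t) = (1 + cmod u) / (1 - cmod u)"
      using u by (simp add: t_def artanh_def add_pos_nonneg)
    then have "exp (- 2 * t) = (1 - cmod u) / (1 + cmod u)"
      by (simp add: exp_minus)
    then show ?thesis
      unfolding tanh_real_altdef using u
      by (simp add: divide_simps add_nonneg_eq_0_iff) (simp add: algebra_simps)
  qed
  have g: "disk_geodesic e (cnj a * e)"
    by unfold_locales (use a e in \<open>auto simp: norm_mult\<close>)
  then interpret disk_geodesic e "cnj a * e" .
  have "e * cnj e = 1"
    using e(1) by (simp add: complex_norm_square[symmetric])
  then have "e * (complex_of_real (cmod u) + cnj (cnj a * e)) = u + a"
    using e(2) by (simp add: distrib_left mult.left_commute)
  moreover have "cnj a * e * complex_of_real (cmod u) = cnj a * u"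
    using e(2) by (simp add: mult.assoc)
  ultimately have "geo t = (u + a) / (1 + cnj a * u)"
    unfolding geo_def den_def tu by simp
  also have "\<dots> = z"
  proof -
    have "cmod (cnj a * a) < 1"
      using a by (simp add: norm_mult abs_square_less_1 flip: power2_eq_square)
    then have "1 - cnj a * a \<noteq> 0"
      by (metis less_irrefl norm_one right_minus_eq)
    have "u + a = z * (1 - cnj a * a) / (1 - cnj a * z)"
      using az by (simp add: u_def divide_simps) (simp add: algebra_simps)
    moreover have "1 + cnj a * u = (1 - cnj a * a) / (1 - cnj a * z)"
      using az by (simp add: u_def divide_simps) (simp add: algebra_simps)
    ultimately show ?thesis using az \<open>1 - cnj a * a \<noteq> 0\<close> by simp
  qed
  finally show thesis
    using that e t0 g by blast
qed

section \<open>A comparison principle for a second-order inequality\<close>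

text \<open>The operator factors: \<open>V'' - \<alpha>\<^sup>2 V = (d/dt - \<alpha>) (V' + \<alpha> V)\<close>. Two first-order comparisons, for
  \<open>V' + \<alpha> V\<close> and then for \<open>V\<close>, therefore suffice, each with its integrating factor. The gap
  \<open>\<alpha> - b\<close> between the two slopes is a lower bound for the initial value of \<open>V' + \<alpha> V\<close> relative to \<open>V\<close>.\<close>

lemma exponential_growth_comparison:
  fixes V V' V'' :: "real \<Rightarrow> real"
  assumes V: "\<And>t. t \<ge> 0 \<Longrightarrow> (V has_real_derivative V' t) (at t)"
    and V': "\<And>t. t \<ge> 0 \<Longrightarrow> (V' has_real_derivative V'' t) (at t)"
    and conv: "\<And>t. t \<ge> 0 \<Longrightarrow> V'' t \<ge> \<alpha>\<^sup>2 * V t"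
    and init: "V 0 \<ge> 0" "V' 0 \<ge> - b * V 0"
    and \<alpha>: "\<alpha> > 0" "0 \<le> b" "b \<le> \<alpha>" and t: "t \<ge> 0"
  shows "V t \<ge> (\<alpha> - b) / (2 * \<alpha>) * V 0 * exp (\<alpha> * t)"
proof -
  define m where "m = (\<alpha> - b) * V 0"
  have first: "V' s + \<alpha> * V s \<ge> m * exp (\<alpha> * s)" if "s \<ge> 0" for s
  proof -
    have "exp (- \<alpha> * 0) * (V' 0 + \<alpha> * V 0) \<le> exp (- \<alpha> * s) * (V' s + \<alpha> * V s)"
    proof (rule DERIV_nonneg_imp_nondecreasing[OF that], intro exI conjI)
      fix r :: real assume "0 \<le> r"
      show "((\<lambda>s. exp (- \<alpha> * s) * (V' s + \<alpha> * V s)) has_real_derivative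
          exp (- \<alpha> * r) * (V'' r - \<alpha>\<^sup>2 * V r)) (at r)"
        by (auto intro!: derivative_eq_intros V[OF \<open>0 \<le> r\<close>] V'[OF \<open>0 \<le> r\<close>]
            simp: algebra_simps power2_eq_square)
      show "0 \<le> exp (- \<alpha> * r) * (V'' r - \<alpha>\<^sup>2 * V r)"
        using conv[OF \<open>0 \<le> r\<close>] by simp
    qed
    moreover have "m \<le> V' 0 + \<alpha> * V 0"
      using init by (simp add: m_def algebra_simps)
    ultimately have "m \<le> exp (- \<alpha> * s) * (V' s + \<alpha> * V s)"
      by simp
    then show ?thesis
      by (simp add: exp_minus field_simps)
  qed
  have "exp (\<alpha> * 0) * V 0 - m / (2 * \<alpha>) * exp (2 * \<alpha> * 0)
      \<le> exp (\<alpha> * t) * V t - m / (2 * \<alpha>) * exp (2 * \<alpha> * t)"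
  proof (rule DERIV_nonneg_imp_nondecreasing[OF t], intro exI conjI)
    fix r :: real assume r: "0 \<le> r"
    show "((\<lambda>s. exp (\<alpha> * s) * V s - m / (2 * \<alpha>) * exp (2 * \<alpha> * s)) has_real_derivative
        exp (\<alpha> * r) * (V' r + \<alpha> * V r - m * exp (\<alpha> * r))) (at r)"
      using \<alpha> by (auto intro!: derivative_eq_intros V[OF r] simp: algebra_simps simp flip: exp_add)
    show "0 \<le> exp (\<alpha> * r) * (V' r + \<alpha> * V r - m * exp (\<alpha> * r))"
      using first[OF r] by simp
  qed
  moreover have "m / (2 * \<alpha>) \<le> V 0"
  proof -
    have "(\<alpha> - b) * V 0 \<le> (2 * \<alpha>) * V 0"
      using \<alpha> init by (intro mult_right_mono) auto
    then show ?thesis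
      using \<alpha> by (simp add: m_def divide_simps mult.commute)
  qed
  ultimately have "m / (2 * \<alpha>) * exp (2 * \<alpha> * t) \<le> exp (\<alpha> * t) * V t"
    by simp
  moreover have "exp (2 * \<alpha> * t) = exp (\<alpha> * t) * exp (\<alpha> * t)"
    by (simp flip: exp_add)
  ultimately have "exp (\<alpha> * t) * (m / (2 * \<alpha>) * exp (\<alpha> * t)) \<le> exp (\<alpha> * t) * V t"
    by (simp add: mult_ac)
  then have "m / (2 * \<alpha>) * exp (\<alpha> * t) \<le> V t"
    by (rule mult_left_le_imp_le) simp
  then show ?thesis
    by (simp add: m_def)
qed

section \<open>The Jacobian along a geodesic\<close>

context disk_geodesic
begin

definition log_jac :: "(complex \<Rightarrow> complex) \<Rightarrow> real \<Rightarrow> real" where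
  "log_jac f t = ln (jac f (geo t)) + ln (geo' t \<bullet> geo' t)"

text \<open>The pre-Schwarzian of \<open>f \<circ> geo\<close>, where \<open>geo\<close> is continued analytically to complex \<open>t\<close>.\<close>

definition geo_pre :: "(complex \<Rightarrow> complex) \<Rightarrow> real \<Rightarrow> complex" where
  "geo_pre f t = pre_schwarzian f (geo t) * geo' t - 2 * accel t"

lemma log_jac_derivative:
  assumes f: "harmonic_decomp f h g" and sp: "sense_preserving f"
  shows "(log_jac f has_real_derivative 2 * Re (geo_pre f t)) (at t)"
proof -
  have "((\<lambda>t. ln (jac f (geo t))) has_derivative
      (\<lambda>s. 2 * Re (pre_schwarzian f (geo t) * (s *\<^sub>R geo' t)))) (at t)"
    using geo_derivative[unfolded has_vector_derivative_def]
      has_derivative_ln_jac[OF f sp geo_in_disk] by (rule has_derivative_compose)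
  then have 1: "((\<lambda>t. ln (jac f (geo t))) has_real_derivative
      2 * Re (pre_schwarzian f (geo t) * geo' t)) (at t)"
    unfolding has_field_derivative_def by (rule has_derivative_eq_rhs) (simp add: fun_eq_iff algebra_simps)
  have pos: "geo' t \<bullet> geo' t > 0"
    using geo'_nonzero by simp
  have d: "(geo' has_derivative (\<lambda>s. s *\<^sub>R (- 2 * accel t * geo' t))) (at t)"
    using geo'_derivative by (simp add: has_vector_derivative_def)
  \<comment> \<open>only the component of the acceleration along the velocity changes the speed\<close>
  have inn: "geo' t \<bullet> (s *\<^sub>R (- 2 * accel t * geo' t)) = s * (- 2 * Re (accel t)) * (geo' t \<bullet> geo' t)" for s
    by (simp add: inner_complex_def algebra_simps)
  have "((\<lambda>t. ln (geo' t \<bullet> geo' t)) has_derivative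
     (\<lambda>s. 2 * (geo' t \<bullet> (s *\<^sub>R (- 2 * accel t * geo' t))) / (geo' t \<bullet> geo' t))) (at t)"
    using pos by (auto intro!: derivative_eq_intros d simp: inner_commute divide_inverse)
  then have 2: "((\<lambda>t. ln (geo' t \<bullet> geo' t)) has_real_derivative - 4 * Re (accel t)) (at t)"
    unfolding has_field_derivative_def inn
    by (rule has_derivative_eq_rhs) (use pos in \<open>simp add: fun_eq_iff\<close>)
  show ?thesis
    unfolding log_jac_def[abs_def] geo_pre_def
    by (rule DERIV_cong[OF DERIV_add[OF 1 2]]) simp
qed

text \<open>Up to the last term, this is the composition law for Schwarzian derivatives, in the form
  \<open>Q' - Q\<^sup>2/2 = S\<^sub>f(\<zeta>) \<zeta>'\<^sup>2 + S\<^sub>\<zeta>\<close> with \<open>S\<^sub>\<zeta> = -2\<close>. The last term appears because a real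
  direction also sees the conjugate-linear part of the differential of the pre-Schwarzian.\<close>

lemma geo_pre_derivative:
  assumes f: "harmonic_decomp f h g" and sp: "sense_preserving f"
  shows "(geo_pre f has_vector_derivative
    schwarzian f (geo t) * (geo' t)\<^sup>2 + (geo_pre f t)\<^sup>2 / 2 - 2
      - complex_of_real ((cmod (deriv (dilatation f) (geo t)))\<^sup>2
          / (1 - (cmod (dilatation f (geo t)))\<^sup>2)\<^sup>2 * (cmod (geo' t))\<^sup>2)) (at t)"
proof -
  define S where "S = schwarzian f (geo t)"
  define P where "P = pre_schwarzian f (geo t)"
  define W where "W = (cmod (deriv (dilatation f) (geo t)))\<^sup>2 / (1 - (cmod (dilatation f (geo t)))\<^sup>2)\<^sup>2"
  have "((\<lambda>t. pre_schwarzian f (geo t)) has_derivative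
      (\<lambda>s. (S + P\<^sup>2 / 2) * (s *\<^sub>R geo' t) - complex_of_real W * cnj (s *\<^sub>R geo' t))) (at t)"
    unfolding S_def P_def W_def
    using geo_derivative[unfolded has_vector_derivative_def]
      has_derivative_pre_schwarzian[OF f sp geo_in_disk] by (rule has_derivative_compose)
  then have 1: "((\<lambda>t. pre_schwarzian f (geo t)) has_vector_derivative
      (S + P\<^sup>2 / 2) * geo' t - complex_of_real W * cnj (geo' t)) (at t)"
    unfolding has_vector_derivative_def
    by (rule has_derivative_eq_rhs) (simp add: fun_eq_iff algebra_simps)
  have "(geo_pre f has_vector_derivative
     (P * (- 2 * accel t * geo' t) + ((S + P\<^sup>2 / 2) * geo' t - complex_of_real W * cnj (geo' t)) * geo' t)
       - 2 * (1 - (accel t)\<^sup>2)) (at t)"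
    unfolding geo_pre_def[abs_def] P_def
    by (intro has_vector_derivative_diff has_vector_derivative_mult 1[unfolded P_def]
        geo'_derivative has_vector_derivative_mult_right accel_derivative)
  then show ?thesis
  proof (rule has_vector_derivative_eq_rhs)
    have gg: "complex_of_real ((cmod (geo' t))\<^sup>2) = geo' t * cnj (geo' t)"
      by (rule complex_norm_square)
    show "(P * (- 2 * accel t * geo' t) + ((S + P\<^sup>2 / 2) * geo' t - complex_of_real W * cnj (geo' t)) * geo' t)
       - 2 * (1 - (accel t)\<^sup>2) = schwarzian f (geo t) * (geo' t)\<^sup>2 + (geo_pre f t)\<^sup>2 / 2 - 2
      - complex_of_real ((cmod (deriv (dilatation f) (geo t)))\<^sup>2
          / (1 - (cmod (dilatation f (geo t)))\<^sup>2)\<^sup>2 * (cmod (geo' t))\<^sup>2)"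
      unfolding geo_pre_def S_def[symmetric] P_def[symmetric] W_def[symmetric] of_real_mult gg
      by (simp add: power2_eq_square field_simps)
  qed
qed

text \<open>The correction \<open>- cnj z\<close> in \<open>A_op\<close> is the contribution of the geodesic's own acceleration, so
  \<open>A_op\<close> is the pre-Schwarzian in hyperbolic coordinates.\<close>

lemma geo_pre_0:
  "geo_pre f 0 = 2 * e * A_op f (geo 0)"
proof -
  have "e * cnj e = 1"
    using norm_e by (simp add: complex_norm_square[symmetric])
  then have "e * (cnj e * c) = c"
    by (simp add: mult.assoc[symmetric])
  then show ?thesis
    using norm_e by (simp add: geo_pre_def A_op_def geo_0 norm_mult algebra_simps)
qed

text \<open>The comparison principle applied to \<open>V = exp (- log_jac / 4)\<close>. The dilatation term enters
  \<open>V''\<close> with the sign opposite to that of the worst case of the Schwarzian term, whence the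
  difference in the hypothesis.\<close>

lemma jacobian_decay:
  assumes f: "harmonic_decomp f h g" and sp: "sense_preserving f"
    and bound: "\<And>z. z \<in> ball 0 1 \<Longrightarrow> cmod (schwarzian f z)
          - (cmod (deriv (dilatation f) z))\<^sup>2 / (1 - (cmod (dilatation f z))\<^sup>2)\<^sup>2
        \<le> 2 * (1 - \<alpha>\<^sup>2) / (1 - (cmod z)\<^sup>2)\<^sup>2"
    and \<alpha>: "\<alpha> > 0" "cmod (A_op f (geo 0)) \<le> \<alpha>" and t: "t \<ge> 0"
  shows "exp (- log_jac f t / 4) \<ge>
    (\<alpha> - cmod (A_op f (geo 0))) / (2 * \<alpha>) * exp (- log_jac f 0 / 4) * exp (\<alpha> * t)"
proof -
  define G where "G t = schwarzian f (geo t) * (geo' t)\<^sup>2 + (geo_pre f t)\<^sup>2 / 2 - 2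
      - complex_of_real ((cmod (deriv (dilatation f) (geo t)))\<^sup>2
          / (1 - (cmod (dilatation f (geo t)))\<^sup>2)\<^sup>2 * (cmod (geo' t))\<^sup>2)" for t
  define V where "V t = exp (- log_jac f t / 4)" for t
  define V' where "V' t = - Re (geo_pre f t) / 2 * V t" for t
  define V'' where "V'' t = ((Re (geo_pre f t))\<^sup>2 / 4 - Re (G t) / 2) * V t" for t
  have V: "(V has_real_derivative V' t) (at t)" for t
    unfolding V_def[abs_def] V'_def
    by (auto intro!: derivative_eq_intros log_jac_derivative[OF f sp])
  have R: "((\<lambda>t. Re (geo_pre f t)) has_real_derivative Re (G t)) (at t)" for t
    using geo_pre_derivative[OF f sp, of t] unfolding G_def[symmetric]
    by (simp add: has_vector_derivative_complex_iff)
  have V': "(V' has_real_derivative V'' t) (at t)" for t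
    unfolding V'_def[abs_def] V''_def
    by (rule DERIV_cong[OF DERIV_mult[OF DERIV_cdivide[OF DERIV_minus[OF R]] V]])
      (simp add: V'_def power2_eq_square algebra_simps)
  have conv: "V'' t \<ge> \<alpha>\<^sup>2 * V t" for t
  proof -
    define W where "W = (cmod (deriv (dilatation f) (geo t)))\<^sup>2
      / (1 - (cmod (dilatation f (geo t)))\<^sup>2)\<^sup>2"
    define S where "S = schwarzian f (geo t)"
    define \<rho> where "\<rho> = (cmod (geo' t))\<^sup>2"
    have \<rho>: "\<rho> > 0"
      using geo'_nonzero by (simp add: \<rho>_def)
    have "cmod S - W \<le> 2 * (1 - \<alpha>\<^sup>2) / \<rho>"
      using bound[OF geo_in_disk[of t]] by (simp add: S_def W_def \<rho>_def geo_unit_speed)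
    then have "cmod S * \<rho> - W * \<rho> \<le> 2 * (1 - \<alpha>\<^sup>2)"
      using \<rho> by (simp only: pos_le_divide_eq left_diff_distrib)
    moreover have "Re (S * (geo' t)\<^sup>2) \<le> cmod S * \<rho>"
      using complex_Re_le_cmod[of "S * (geo' t)\<^sup>2"] by (simp add: \<rho>_def norm_mult norm_power)
    moreover have "Re (G t) = Re (S * (geo' t)\<^sup>2)
        + ((Re (geo_pre f t))\<^sup>2 / 2 - (Im (geo_pre f t))\<^sup>2 / 2) - 2 - W * \<rho>"
    proof -
      have "Re ((geo_pre f t)\<^sup>2 / 2) = (Re (geo_pre f t))\<^sup>2 / 2 - (Im (geo_pre f t))\<^sup>2 / 2"
        by (simp add: power2_eq_square diff_divide_distrib)
      then show ?thesis
        unfolding G_def W_def S_def \<rho>_def minus_complex.sel plus_complex.sel Re_complex_of_real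
        by simp
    qed
    \<comment> \<open>the squares of \<open>Re (geo_pre f t)\<close> cancel here\<close>
    ultimately have "\<alpha>\<^sup>2 \<le> (Re (geo_pre f t))\<^sup>2 / 4 - Re (G t) / 2"
      using zero_le_power2[of "Im (geo_pre f t)"] by argo
    then show ?thesis
      unfolding V''_def by (intro mult_right_mono) (auto simp: V_def)
  qed
  have "Re (geo_pre f 0) \<le> 2 * cmod (A_op f (geo 0))"
    using complex_Re_le_cmod[of "geo_pre f 0"] norm_e by (simp add: geo_pre_0 norm_mult)
  then have "V' 0 \<ge> - cmod (A_op f (geo 0)) * V 0"
    unfolding V'_def by (intro mult_right_mono) (auto simp: V_def)
  from exponential_growth_comparison[of V V' V'', OF V V' conv _ this] \<alpha> t
  show ?thesis
    by (simp add: V_def)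
qed

text \<open>\<open>J = (\<bar>h'\<bar> + \<bar>g'\<bar>) (\<bar>h'\<bar> - \<bar>g'\<bar>)\<close>, and quasiconformality says that the first factor is at most
  \<open>K\<close> times the second, so the square of the largest stretching is at most \<open>K J\<close>.\<close>

lemma speed_le_jacobian:
  assumes f: "harmonic_decomp f h g" and sp: "sense_preserving f" and qc: "quasiconformal K f"
  shows "(cmod (deriv h (geo t)) + cmod (deriv g (geo t))) * cmod (geo' t) \<le> sqrt K * exp (log_jac f t / 2)"
proof -
  define p where "p = cmod (deriv h (geo t))"
  define q where "q = cmod (deriv g (geo t))"
  have J: "jac f (geo t) = p\<^sup>2 - q\<^sup>2" "jac f (geo t) > 0"
    using jac_harmonic[OF f geo_in_disk] bspec[OF sp[unfolded sense_preserving_def] geo_in_disk]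
    unfolding p_def q_def by blast+
  have "p + q \<le> K * (p - q)"
    using bspec[OF conjunct2[OF qc[unfolded quasiconformal_def]] geo_in_disk[of t]]
      wirt_harmonic[OF f geo_in_disk[of t]]
    by (simp add: p_def q_def)
  then have "(p + q) * (p + q) \<le> (p + q) * (K * (p - q))"
    by (intro mult_left_mono) (auto simp: p_def q_def)
  then have "(p + q)\<^sup>2 \<le> K * jac f (geo t)"
    unfolding J(1) by (simp add: power2_eq_square algebra_simps)
  then have "p + q \<le> sqrt K * sqrt (jac f (geo t))"
    unfolding real_sqrt_mult[symmetric] by (rule real_le_rsqrt)
  then have "(p + q) * cmod (geo' t) \<le> sqrt K * sqrt (jac f (geo t)) * cmod (geo' t)"
    by (intro mult_right_mono) auto
  also have "\<dots> = sqrt K * (sqrt (jac f (geo t)) * cmod (geo' t))"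
    by (rule mult.assoc)
  also have "sqrt (jac f (geo t)) * cmod (geo' t) = exp (log_jac f t / 2)"
  proof -
    have "geo' t \<bullet> geo' t > 0"
      using geo'_nonzero by simp
    then have "exp (log_jac f t) = jac f (geo t) * (cmod (geo' t))\<^sup>2"
      using J(2) by (simp add: log_jac_def exp_add power2_norm_eq_inner)
    moreover have "exp (log_jac f t / 2) = sqrt (exp (log_jac f t))"
      by (rule real_sqrt_unique[symmetric]) (simp_all flip: exp_double)
    ultimately show ?thesis
      by (simp add: real_sqrt_mult)
  qed
  finally show ?thesis
    by (simp add: p_def q_def)
qed

text \<open>The bound is the integral over the half-line of \<open>sqrt K exp (- 2 \<alpha> s) / k\<^sup>2\<close>, where
  \<open>k exp (\<alpha> s)\<close> is the lower bound for \<open>exp (- log_jac / 4)\<close>.\<close>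

lemma growth_along_geodesic:
  assumes f: "harmonic_decomp f h g" and sp: "sense_preserving f" and qc: "quasiconformal K f"
    and K: "K > 0"
    and bound: "\<And>z. z \<in> ball 0 1 \<Longrightarrow> cmod (schwarzian f z)
          - (cmod (deriv (dilatation f) z))\<^sup>2 / (1 - (cmod (dilatation f z))\<^sup>2)\<^sup>2
        \<le> 2 * (1 - \<alpha>\<^sup>2) / (1 - (cmod z)\<^sup>2)\<^sup>2"
    and \<alpha>: "cmod (A_op f (geo 0)) < \<alpha>" and t: "t \<ge> 0"
  shows "cmod (f (geo t) - f (geo 0))
    \<le> sqrt K * exp (log_jac f 0 / 2) * 2 * \<alpha> / (\<alpha> - cmod (A_op f (geo 0)))\<^sup>2"
proof -
  have \<alpha>0: "\<alpha> > 0"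
    using \<alpha> norm_ge_zero[of "A_op f (geo 0)"] by linarith
  define k where "k = (\<alpha> - cmod (A_op f (geo 0))) / (2 * \<alpha>) * exp (- log_jac f 0 / 4)"
  have k: "k > 0"
    using \<alpha> \<alpha>0 by (simp add: k_def)
  have decay: "exp (log_jac f s / 2) \<le> exp (- 2 * \<alpha> * s) / k\<^sup>2" if "s \<ge> 0" for s
  proof -
    have "k * exp (\<alpha> * s) \<le> exp (- log_jac f s / 4)"
      using jacobian_decay[OF f sp bound \<alpha>0 _ that] \<alpha> by (simp add: k_def)
    then have "(k * exp (\<alpha> * s))\<^sup>2 \<le> (exp (- log_jac f s / 4))\<^sup>2"
      using k by (intro power_mono) auto
    moreover have "(k * exp (\<alpha> * s))\<^sup>2 = k\<^sup>2 * exp (2 * \<alpha> * s)"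
      by (simp add: power_mult_distrib mult.assoc flip: exp_double)
    moreover have "(exp (- log_jac f s / 4))\<^sup>2 = exp (- (log_jac f s / 2))"
      by (simp flip: exp_double)
    ultimately have "k\<^sup>2 * exp (2 * \<alpha> * s) \<le> exp (- (log_jac f s / 2))"
      by simp
    then show ?thesis
      using k by (simp add: exp_minus field_simps)
  qed
  define F where "F s = h (geo s) + cnj (g (geo s))" for s
  define F' where "F' s = deriv h (geo s) * geo' s + cnj (deriv g (geo s) * geo' s)" for s
  \<comment> \<open>the primitive, vanishing at infinity, of the bound for the speed\<close>
  define \<phi> where "\<phi> s = - (sqrt K / k\<^sup>2 / (2 * \<alpha>)) * exp (- 2 * \<alpha> * s)" for s
  have F: "(F has_vector_derivative F' s) (at s)" for s
  proof -
    have "(h has_field_derivative deriv h (geo s)) (at (geo s))"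
      "(g has_field_derivative deriv g (geo s)) (at (geo s))"
      using f geo_in_disk[of s] by (auto simp: harmonic_decomp_def intro!: holomorphic_derivI)
    from this[THEN field_vector_diff_chain_at[OF geo_derivative]] show ?thesis
      unfolding F_def[abs_def] F'_def
      by (intro has_vector_derivative_add has_vector_derivative_cnj) (auto simp: o_def mult.commute)
  qed
  have \<phi>: "(\<phi> has_vector_derivative sqrt K / k\<^sup>2 * exp (- 2 * \<alpha> * s)) (at s)" for s
    unfolding \<phi>_def[abs_def] has_real_derivative_iff_has_vector_derivative[symmetric]
    using \<alpha>0 k by (auto intro!: derivative_eq_intros simp: field_simps)
  have F': "cmod (F' s) \<le> sqrt K / k\<^sup>2 * exp (- 2 * \<alpha> * s)" if "s \<ge> 0" for s
  proof -
    have "cmod (F' s) \<le> cmod (deriv h (geo s) * geo' s) + cmod (cnj (deriv g (geo s) * geo' s))"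
      unfolding F'_def by (rule norm_triangle_ineq)
    also have "\<dots> = (cmod (deriv h (geo s)) + cmod (deriv g (geo s))) * cmod (geo' s)"
      by (simp only: complex_mod_cnj norm_mult distrib_right)
    also have "\<dots> \<le> sqrt K * exp (log_jac f s / 2)"
      by (rule speed_le_jacobian[OF f sp qc])
    also have "\<dots> \<le> sqrt K * (exp (- 2 * \<alpha> * s) / k\<^sup>2)"
      using decay[OF that] K by (intro mult_left_mono) auto
    finally show ?thesis
      by simp
  qed
  have "cmod (F t - F 0) \<le> \<phi> t - \<phi> 0"
  proof (cases "t = 0")
    case False
    with t have "0 < t" by simp
    then show ?thesis
    proof (rule differentiable_bound_general)
      show "continuous_on {0..t} F" "continuous_on {0..t} \<phi>"
        using F \<phi> by (meson continuous_at_imp_continuous_on has_vector_derivative_continuous)+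
    qed (use F \<phi> F' in auto)
  qed simp
  also have "\<dots> \<le> - \<phi> 0"
    using K k \<alpha>0 by (simp add: \<phi>_def)
  also have "- \<phi> 0 = sqrt K * exp (log_jac f 0 / 2) * 2 * \<alpha> / (\<alpha> - cmod (A_op f (geo 0)))\<^sup>2"
  proof -
    define d where "d = \<alpha> - cmod (A_op f (geo 0))"
    have k2: "k\<^sup>2 = d\<^sup>2 / (2 * \<alpha>)\<^sup>2 / exp (log_jac f 0 / 2)"
      unfolding k_def power_mult_distrib power_divide d_def[symmetric]
      by (simp add: exp_minus field_simps flip: exp_double)
    have "d \<noteq> 0"
      using \<alpha> by (simp add: d_def)
    then show ?thesis
      using \<alpha>0 unfolding \<phi>_def k2 d_def[symmetric] by (simp add: field_simps power2_eq_square)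
  qed
  moreover have "F s = f (geo s)" for s
    using f geo_in_disk[of s] by (simp add: F_def harmonic_decomp_def)
  ultimately show ?thesis
    by simp
qed

end

section \<open>Boundedness\<close>

text \<open>The initial value \<open>log_jac f 0\<close> depends on the base point but not on the direction \<open>e\<close>, so one
  bound serves all geodesics from \<open>a\<close>.\<close>

lemma bounded_of_small_A_op:
  assumes f: "harmonic_decomp f h g" and sp: "sense_preserving f" and qc: "quasiconformal K f"
    and K: "K > 0"
    and bound: "\<And>z. z \<in> ball 0 1 \<Longrightarrow> cmod (schwarzian f z)
          - (cmod (deriv (dilatation f) z))\<^sup>2 / (1 - (cmod (dilatation f z))\<^sup>2)\<^sup>2
        \<le> 2 * (1 - \<alpha>\<^sup>2) / (1 - (cmod z)\<^sup>2)\<^sup>2"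
    and a: "a \<in> ball 0 1" and small: "cmod (A_op f a) < \<alpha>"
  shows "bounded (f ` ball 0 1)"
proof -
  define L where "L = ln (jac f a) + ln ((1 - (cmod a)\<^sup>2)\<^sup>2)"
  define B where "B = sqrt K * exp (L / 2) * 2 * \<alpha> / (\<alpha> - cmod (A_op f a))\<^sup>2"
  have "dist (f a) (f z) \<le> B" if z: "z \<in> ball 0 1" for z
  proof -
    from a z obtain e t where e: "cmod e = 1" and t: "t \<ge> 0"
      and gt: "disk_geodesic.geo e (cnj a * e) t = z" and g: "disk_geodesic e (cnj a * e)"
      by (auto elim: geodesic_through_two_points)
    interpret disk_geodesic e "cnj a * e" by (rule g)
    have "e * cnj e = 1"
      using e by (simp add: complex_norm_square[symmetric])
    then have g0: "geo 0 = a"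
      by (simp add: geo_0)
    have "log_jac f 0 = L"
      using geo_unit_speed[of 0] unfolding log_jac_def L_def
      by (simp add: g0 power2_norm_eq_inner[symmetric])
    with growth_along_geodesic[OF f sp qc K bound _ t] small show ?thesis
      by (simp add: g0 gt B_def dist_norm norm_minus_commute)
  qed
  then show ?thesis
    unfolding bounded_def by blast
qed

theorem theorem1:
  fixes f :: "complex \<Rightarrow> complex" and lam K :: real
  assumes "0 < lam" and "lam < 1" and "K > 0"
    and "f \<in> NH lam K"
    and "\<not> bounded (f ` ball 0 1)"
  shows "lower_order f \<ge> sqrt (1 - lam)"
proof -
  obtain h g where f: "harmonic_decomp f h g" and sp: "sense_preserving f" and qc: "quasiconformal K f"
    and NH: "\<And>z. z \<in> ball 0 1 \<Longrightarrow> cmod (schwarzian f z)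
          + (cmod (deriv (dilatation f) z))\<^sup>2 / (1 - (cmod (dilatation f z))\<^sup>2)\<^sup>2
        \<le> 2 * lam / (1 - (cmod z)\<^sup>2)\<^sup>2"
    using assms(4) by (auto simp: NH_def harmonic_mapping_def)
  have bound: "cmod (schwarzian f z)
          - (cmod (deriv (dilatation f) z))\<^sup>2 / (1 - (cmod (dilatation f z))\<^sup>2)\<^sup>2
        \<le> 2 * (1 - (sqrt (1 - lam))\<^sup>2) / (1 - (cmod z)\<^sup>2)\<^sup>2" if "z \<in> ball 0 1" for z
  proof -
    have "0 \<le> (cmod (deriv (dilatation f) z))\<^sup>2 / (1 - (cmod (dilatation f z))\<^sup>2)\<^sup>2"
      by simp
    with NH[OF that] have "cmod (schwarzian f z)
          - (cmod (deriv (dilatation f) z))\<^sup>2 / (1 - (cmod (dilatation f z))\<^sup>2)\<^sup>2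
        \<le> 2 * lam / (1 - (cmod z)\<^sup>2)\<^sup>2"
      by linarith
    then show ?thesis
      using \<open>lam < 1\<close> by simp
  qed
  have "sqrt (1 - lam) \<le> cmod (A_op f a)" if "a \<in> ball 0 1" for a
    using bounded_of_small_A_op[OF f sp qc \<open>K > 0\<close> bound that] assms(5) by force
  then show ?thesis
    unfolding lower_order_def by (intro cINF_greatest) auto
qed

end
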